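(* Let $G$ be a finite simple group. Then $\mathcal{Q}(G)$, the set of quandle isomorphism classes of generalized Alexander quandles $Q(G,\psi)$ with $\psi\in\mathrm{Aut}(G)$, is in one-to-one correspondence with the set of conjugacy classes of the group $\mathrm{Aut}(G)$, via $\psi\mapsto Q(G,\psi)$; that is, for $\psi,\psi'\in\mathrm{Aut}(G)$, the quandles $Q(G,\psi)$ and $Q(G,\psi')$ are isomorphic if and only if $\psi$ and $\psi'$ are conjugate in $\mathrm{Aut}(G)$.
   Context: For a finite group $G$ and a group automorphism $\psi\in\mathrm{Aut}(G)$, the generalized Alexander quandle $Q(G,\psi)$ is the set $G$ equipped with the maps $s_x:G\to G$, $s_x(y)=x\psi(x^{-1}y)$, for $x\in G$. A quandle isomorphism from $(Q,s)$ to $(Q',s')$ is a bijection $f:Q\to Q'$ with $f\circ s_x=s'_{f(x)}\circ f$ for all $x\in Q$. $\mathcal{Q}(G)=\{Q(G,\psi):\psi\in\mathrm{Aut}(G)\}/\cong$, where $\cong$ is quandle isomorphism. *)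

theory Defs
  imports "HOL-Algebra.Bij" "HOL-Algebra.SimpleGroups"
begin

section \<open>Quandles\<close>

text \<open>As for \<open>monoid\<close> and \<open>group\<close> in HOL-Algebra, the record carries only the data
  (the set and the maps \<open>y \<mapsto> smap Q x y\<close>); the axioms are in the locale.\<close>

record 'a quandle = "'a partial_object" +
  smap :: "'a \<Rightarrow> 'a \<Rightarrow> 'a"

locale quandle =
  fixes Q :: "('a, 'm) quandle_scheme"
  assumes idem: "x \<in> carrier Q \<Longrightarrow> smap Q x x = x"
    and bij: "x \<in> carrier Q \<Longrightarrow> bij_betw (smap Q x) (carrier Q) (carrier Q)"
    and distrib: "\<lbrakk>x \<in> carrier Q; y \<in> carrier Q; z \<in> carrier Q\<rbrakk> \<Longrightarrow>
      smap Q x (smap Q y z) = smap Q (smap Q x y) (smap Q x z)"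

definition quandle_iso :: "('a, 'm) quandle_scheme \<Rightarrow> ('b, 'n) quandle_scheme \<Rightarrow> ('a \<Rightarrow> 'b) set"
  where "quandle_iso Q Q' =
    {f. bij_betw f (carrier Q) (carrier Q') \<and>
        (\<forall>x\<in>carrier Q. \<forall>y\<in>carrier Q. f (smap Q x y) = smap Q' (f x) (f y))}"

definition quandle_isomorphic :: "('a, 'm) quandle_scheme \<Rightarrow> ('b, 'n) quandle_scheme \<Rightarrow> bool"
  where "quandle_isomorphic Q Q' \<longleftrightarrow> quandle_iso Q Q' \<noteq> {}"

section \<open>Generalized Alexander quandles\<close>

text \<open>The maps are made extensional on the carrier, so that the record depends only on
  the mathematical object.\<close>

definition alexander_quandle :: "('a, 'm) monoid_scheme \<Rightarrow> ('a \<Rightarrow> 'a) \<Rightarrow> 'a quandle"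
  where "alexander_quandle G \<psi> =
    \<lparr>carrier = carrier G,
     smap = \<lambda>x\<in>carrier G. \<lambda>y\<in>carrier G. x \<otimes>\<^bsub>G\<^esub> \<psi> (inv\<^bsub>G\<^esub> x \<otimes>\<^bsub>G\<^esub> y)\<rparr>"

definition alexander_quandles :: "('a, 'm) monoid_scheme \<Rightarrow> 'a quandle set"
  where "alexander_quandles G = alexander_quandle G ` carrier (AutoGroup G)"

definition alexander_iso_rel :: "('a, 'm) monoid_scheme \<Rightarrow> ('a quandle \<times> 'a quandle) set"
  where "alexander_iso_rel G =
    {(Q, Q'). Q \<in> alexander_quandles G \<and> Q' \<in> alexander_quandles G \<and> quandle_isomorphic Q Q'}"

definition alexander_iso_classes :: "('a, 'm) monoid_scheme \<Rightarrow> 'a quandle set set"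
  where "alexander_iso_classes G = alexander_quandles G // alexander_iso_rel G"

section \<open>Conjugacy\<close>

definition conjugate :: "('a, 'm) monoid_scheme \<Rightarrow> 'a \<Rightarrow> 'a \<Rightarrow> bool"
  where "conjugate G a b \<longleftrightarrow> (\<exists>g\<in>carrier G. b = g \<otimes>\<^bsub>G\<^esub> a \<otimes>\<^bsub>G\<^esub> inv\<^bsub>G\<^esub> g)"

definition conjugacy_rel :: "('a, 'm) monoid_scheme \<Rightarrow> ('a \<times> 'a) set"
  where "conjugacy_rel G = {(a, b). a \<in> carrier G \<and> b \<in> carrier G \<and> conjugate G a b}"

definition conjugacy_classes :: "('a, 'm) monoid_scheme \<Rightarrow> 'a set set"
  where "conjugacy_classes G = carrier G // conjugacy_rel G"

section \<open>Well-definedness\<close>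

lemma carrier_AutoGroup: "carrier (AutoGroup G) = auto G"
  by (simp add: AutoGroup_def)

lemma (in group) quandle_alexander_quandle:
  assumes "\<psi> \<in> carrier (AutoGroup G)"
  shows "quandle (alexander_quandle G \<psi>)"
proof -
  have hom: "\<psi> \<in> hom G G" and bij: "bij_betw \<psi> (carrier G) (carrier G)"
    using assms by (auto simp: carrier_AutoGroup auto_def Bij_def)
  interpret \<psi>: group_hom G G \<psi>
    by unfold_locales (rule hom)
  have cancel: "a \<otimes> (inv a \<otimes> b) = b" "inv a \<otimes> (a \<otimes> b) = b"
    if "a \<in> carrier G" "b \<in> carrier G" for a b
    using that by (simp_all add: m_assoc[symmetric])
  show ?thesis
  proof
    fix x assume "x \<in> carrier (alexander_quandle G \<psi>)"
    then have x: "x \<in> carrier G" by (simp add: alexander_quandle_def)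
    then show "smap (alexander_quandle G \<psi>) x x = x"
      by (simp add: alexander_quandle_def)
    have trans: "bij_betw (\<lambda>y. a \<otimes> y) (carrier G) (carrier G)" if "a \<in> carrier G" for a
      using that
      by (intro bij_betw_byWitness[where f' = "\<lambda>y. inv a \<otimes> y"]) (auto simp: m_assoc[symmetric])
    have "bij_betw ((\<lambda>y. x \<otimes> y) \<circ> (\<psi> \<circ> (\<lambda>y. inv x \<otimes> y))) (carrier G) (carrier G)"
      using x by (intro bij_betw_trans[OF bij_betw_trans[OF trans bij] trans]) auto
    moreover have "((\<lambda>y. x \<otimes> y) \<circ> (\<psi> \<circ> (\<lambda>y. inv x \<otimes> y))) y = smap (alexander_quandle G \<psi>) x y"
      if "y \<in> carrier G" for y
      using x that by (simp add: alexander_quandle_def)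
    ultimately have "bij_betw (smap (alexander_quandle G \<psi>) x) (carrier G) (carrier G)"
      using bij_betw_cong by blast
    then show "bij_betw (smap (alexander_quandle G \<psi>) x)
        (carrier (alexander_quandle G \<psi>)) (carrier (alexander_quandle G \<psi>))"
      by (simp add: alexander_quandle_def)
  next
    fix x y z
    assume "x \<in> carrier (alexander_quandle G \<psi>)" "y \<in> carrier (alexander_quandle G \<psi>)"
      "z \<in> carrier (alexander_quandle G \<psi>)"
    then have "x \<in> carrier G" "y \<in> carrier G" "z \<in> carrier G"
      by (simp_all add: alexander_quandle_def)
    then show "smap (alexander_quandle G \<psi>) x (smap (alexander_quandle G \<psi>) y z) =
        smap (alexander_quandle G \<psi>) (smap (alexander_quandle G \<psi>) x y)
          (smap (alexander_quandle G \<psi>) x z)"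
      by (simp add: alexander_quandle_def inv_mult_group m_assoc cancel)
  qed
qed

lemma (in quandle) smap_closed:
  "\<lbrakk>x \<in> carrier Q; y \<in> carrier Q\<rbrakk> \<Longrightarrow> smap Q x y \<in> carrier Q"
  using bij bij_betwE by blast

lemma quandle_isomorphic_refl: "quandle_isomorphic Q Q"
  unfolding quandle_isomorphic_def quandle_iso_def using bij_betw_id[of "carrier Q"]
  by (auto intro: exI[of _ id])

lemma quandle_isomorphic_sym:
  assumes "quandle Q" "quandle_isomorphic Q Q'"
  shows "quandle_isomorphic Q' Q"
proof -
  interpret quandle Q by fact
  obtain f where f: "bij_betw f (carrier Q) (carrier Q')"
    and h: "\<And>x y. \<lbrakk>x \<in> carrier Q; y \<in> carrier Q\<rbrakk> \<Longrightarrow> f (smap Q x y) = smap Q' (f x) (f y)"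
    using assms(2) by (auto simp: quandle_isomorphic_def quandle_iso_def)
  let ?g = "inv_into (carrier Q) f"
  have g: "bij_betw ?g (carrier Q') (carrier Q)"
    using f by (rule bij_betw_inv_into)
  have "?g (smap Q' x y) = smap Q (?g x) (?g y)"
    if "x \<in> carrier Q'" "y \<in> carrier Q'" for x y
  proof -
    have c: "?g x \<in> carrier Q" "?g y \<in> carrier Q" using g that by (auto dest: bij_betwE)
    have "f (smap Q (?g x) (?g y)) = smap Q' x y"
      using h[OF c] that f by (simp add: bij_betw_inv_into_right)
    then show ?thesis using c smap_closed f by (metis bij_betw_inv_into_left)
  qed
  then have "?g \<in> quandle_iso Q' Q" using g by (auto simp: quandle_iso_def)
  then show ?thesis by (auto simp: quandle_isomorphic_def)
qed

lemma quandle_isomorphic_trans: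
  assumes "quandle_isomorphic Q Q'" "quandle_isomorphic Q' Q''"
  shows "quandle_isomorphic Q Q''"
proof -
  obtain f g where f: "f \<in> quandle_iso Q Q'" and g: "g \<in> quandle_iso Q' Q''"
    using assms by (auto simp: quandle_isomorphic_def)
  then have "g \<circ> f \<in> quandle_iso Q Q''"
    by (auto simp: quandle_iso_def intro: bij_betw_trans dest: bij_betwE)
  then show ?thesis by (auto simp: quandle_isomorphic_def)
qed

lemma (in group) equiv_alexander_iso_rel:
  "equiv (alexander_quandles G) (alexander_iso_rel G)"
proof (rule equivI)
  show "alexander_iso_rel G \<subseteq> alexander_quandles G \<times> alexander_quandles G"
    by (auto simp: alexander_iso_rel_def)
  show "refl_on (alexander_quandles G) (alexander_iso_rel G)"
    by (auto simp: refl_on_def alexander_iso_rel_def quandle_isomorphic_refl)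
  show "sym (alexander_iso_rel G)"
    using quandle_isomorphic_sym quandle_alexander_quandle
    by (fastforce simp: sym_def alexander_iso_rel_def alexander_quandles_def)
  show "trans (alexander_iso_rel G)"
    using quandle_isomorphic_trans unfolding trans_def alexander_iso_rel_def by blast
qed

lemma (in group) equiv_conjugacy_rel: "equiv (carrier G) (conjugacy_rel G)"
proof (rule equivI)
  show "conjugacy_rel G \<subseteq> carrier G \<times> carrier G"
    by (auto simp: conjugacy_rel_def)
  show "refl_on (carrier G) (conjugacy_rel G)"
    by (auto simp: refl_on_def conjugacy_rel_def conjugate_def intro!: bexI[of _ "\<one>"])
  show "sym (conjugacy_rel G)"
  proof (rule symI)
    fix a b assume "(a, b) \<in> conjugacy_rel G"
    then obtain g where g: "a \<in> carrier G" "b \<in> carrier G" "g \<in> carrier G" "b = g \<otimes> a \<otimes> inv g"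
      by (auto simp: conjugacy_rel_def conjugate_def)
    then have "a = inv g \<otimes> b \<otimes> inv (inv g)"
      by (simp add: m_assoc[symmetric]) (simp add: m_assoc)
    with g show "(b, a) \<in> conjugacy_rel G"
      unfolding conjugacy_rel_def conjugate_def by blast
  qed
  show "trans (conjugacy_rel G)"
  proof (rule transI)
    fix a b c assume "(a, b) \<in> conjugacy_rel G" "(b, c) \<in> conjugacy_rel G"
    then obtain g h where g: "a \<in> carrier G" "g \<in> carrier G" "b = g \<otimes> a \<otimes> inv g"
      and h: "c \<in> carrier G" "h \<in> carrier G" "c = h \<otimes> b \<otimes> inv h"
      by (auto simp: conjugacy_rel_def conjugate_def)
    then have "c = (h \<otimes> g) \<otimes> a \<otimes> inv (h \<otimes> g)"
      by (simp add: m_assoc inv_mult_group)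
    with g h show "(a, c) \<in> conjugacy_rel G"
      unfolding conjugacy_rel_def conjugate_def by blast
  qed
qed

end

theory Submission
  imports Defs "HOL-Algebra.Generated_Groups"
begin

text \<open>Conjugate automorphisms give isomorphic quandles because an automorphism \<open>\<chi>\<close> with
  \<open>\<chi> \<psi> = \<psi>' \<chi>\<close> is itself a quandle isomorphism.  For the converse, left translations are
  automorphisms of \<open>Q(G, \<psi>')\<close>, so an isomorphism \<open>f\<close> may be assumed to fix \<open>\<one>\<close>.  As \<open>s\<^sub>\<one> = \<psi>\<close>,
  such an \<open>f\<close> intertwines \<open>\<psi>\<close> and \<open>\<psi>'\<close>; only multiplicativity can fail.  Substituting
  \<open>\<psi> y\<close> by an arbitrary element in \<open>f (x \<psi> (x\<inverse> y)) = f x \<psi>' ((f x)\<inverse> f y)\<close> shows that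
  \<open>f (a z) = f a f z\<close> for every \<open>z\<close> and every displacement \<open>a = x (\<psi> x)\<inverse>\<close>.

  The elements \<open>a\<close> with this property form a subgroup, while the displacements generate a normal
  subgroup (\<open>generate_displacements_normal\<close>).  In a simple group there are two cases.  If the
  displacements generate \<open>G\<close>, then \<open>f\<close> is an automorphism conjugating \<open>\<psi>\<close> to \<open>\<psi>'\<close>.  If they are
  all trivial, then \<open>\<psi>\<close> is the identity, and \<open>\<psi>' f = f \<psi> = f\<close> forces \<open>\<psi>'\<close> to be the identity
  too.\<close>

lemma (in group) conjugate_iff_intertwined:
  assumes "a \<in> carrier G" "b \<in> carrier G"
  shows "conjugate G a b \<longleftrightarrow> (\<exists>g\<in>carrier G. b \<otimes> g = g \<otimes> a)"
proof -
  have "b = g \<otimes> a \<otimes> inv g \<longleftrightarrow> b \<otimes> g = g \<otimes> a" if "g \<in> carrier G" for g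
    using that assms by (metis inv_solve_right m_closed)
  then show ?thesis unfolding conjugate_def by blast
qed

lemma (in group) conjugate_AutoGroup_iff:
  assumes \<psi>: "\<psi> \<in> auto G" and \<psi>': "\<psi>' \<in> auto G"
  shows "conjugate (AutoGroup G) \<psi> \<psi>' \<longleftrightarrow>
    (\<exists>\<chi>\<in>auto G. \<forall>x\<in>carrier G. \<psi>' (\<chi> x) = \<chi> (\<psi> x))"
proof -
  interpret Aut: group "AutoGroup G" by (rule AutoGroup)
  have eq: "\<psi>' \<otimes>\<^bsub>AutoGroup G\<^esub> \<chi> = \<chi> \<otimes>\<^bsub>AutoGroup G\<^esub> \<psi> \<longleftrightarrow>
      (\<forall>x\<in>carrier G. \<psi>' (\<chi> x) = \<chi> (\<psi> x))" if "\<chi> \<in> auto G" for \<chi>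
  proof -
    have "\<psi>' \<otimes>\<^bsub>AutoGroup G\<^esub> \<chi> = compose (carrier G) \<psi>' \<chi>"
      "\<chi> \<otimes>\<^bsub>AutoGroup G\<^esub> \<psi> = compose (carrier G) \<chi> \<psi>"
      using \<psi> \<psi>' that by (auto simp: AutoGroup_def BijGroup_def auto_def)
    then show ?thesis by (auto simp: compose_def restrict_def fun_eq_iff)
  qed
  show ?thesis
    using Aut.conjugate_iff_intertwined[of \<psi> \<psi>'] \<psi> \<psi>' eq by (auto simp: carrier_AutoGroup)
qed

section \<open>Displacements of an endomorphism\<close>

definition displacements :: "('a, 'm) monoid_scheme \<Rightarrow> ('a \<Rightarrow> 'a) \<Rightarrow> 'a set"
  where "displacements G \<psi> = (\<lambda>x. x \<otimes>\<^bsub>G\<^esub> inv\<^bsub>G\<^esub> (\<psi> x)) ` carrier G"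

text \<open>Writing \<open>\<delta> x = x (\<psi> x)\<inverse>\<close>, the cocycle identity \<open>\<delta> (g x) = g (\<delta> x) g\<inverse> (\<delta> g)\<close> expresses each
  conjugate of a displacement as a quotient of two displacements.\<close>

lemma (in group) generate_displacements_normal:
  assumes hom: "\<psi> \<in> hom G G"
  shows "generate G (displacements G \<psi>) \<lhd> G"
proof -
  interpret \<psi>: group_hom G G \<psi> by unfold_locales (rule hom)
  let ?D = "displacements G \<psi>"
  have sub: "?D \<subseteq> carrier G" by (auto simp: displacements_def)
  have gen: "g \<otimes> d \<otimes> inv g \<in> generate G ?D" if d: "d \<in> ?D" and g: "g \<in> carrier G" for g d
  proof -
    obtain x where x: "x \<in> carrier G" "d = x \<otimes> inv (\<psi> x)"
      using d by (auto simp: displacements_def)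
    have "g \<otimes> d \<otimes> inv g = (g \<otimes> x \<otimes> inv (\<psi> (g \<otimes> x))) \<otimes> inv (g \<otimes> inv (\<psi> g))"
    proof -
      have "inv (\<psi> g) \<otimes> (\<psi> g \<otimes> inv g) = inv g"
        using g by (simp add: m_assoc[symmetric])
      then show ?thesis using g x by (simp add: inv_mult_group m_assoc)
    qed
    moreover have "g \<otimes> x \<otimes> inv (\<psi> (g \<otimes> x)) \<in> ?D" "g \<otimes> inv (\<psi> g) \<in> ?D"
      using g x unfolding displacements_def by blast+
    ultimately show ?thesis
      using generate.eng[OF generate.incl generate.inv] by metis
  qed
  have "g \<otimes> h \<otimes> inv g \<in> generate G ?D" if "h \<in> generate G ?D" "g \<in> carrier G" for g h
    using that(1)
  proof (induction rule: generate.induct)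
    case one
    then show ?case using that(2) by (simp add: generate.one)
  next
    case (incl h)
    then show ?case using gen that(2) by blast
  next
    case (inv h)
    then have "g \<otimes> inv h \<otimes> inv g = inv (g \<otimes> h \<otimes> inv g)"
      using that(2) sub by (auto simp: inv_mult_group m_assoc)
    then show ?case
      using gen[OF inv that(2)] generate_m_inv_closed[OF sub] by metis
  next
    case (eng h k)
    then have "h \<in> carrier G" "k \<in> carrier G"
      using generate_in_carrier[OF sub] by auto
    then have "g \<otimes> (h \<otimes> k) \<otimes> inv g = (g \<otimes> h \<otimes> inv g) \<otimes> (g \<otimes> k \<otimes> inv g)"
      using that(2) by (simp add: m_assoc inv_solve_left)
    then show ?case using generate.eng[OF eng.IH] by simp
  qed
  then show ?thesis
    using generate_is_subgroup[OF sub] by (auto simp: normal_inv_iff)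
qed

lemma (in group) subgroup_left_multiplicative:
  assumes H: "group H" and f: "f \<in> carrier G \<rightarrow> carrier H" and one: "f \<one> = \<one>\<^bsub>H\<^esub>"
  shows "subgroup {a \<in> carrier G. \<forall>z\<in>carrier G. f (a \<otimes> z) = f a \<otimes>\<^bsub>H\<^esub> f z} G" (is "subgroup ?M G")
proof -
  interpret H: group H by fact
  have fc: "f x \<in> carrier H" if "x \<in> carrier G" for x using f that by auto
  show ?thesis
  proof (rule subgroupI)
    have "\<one> \<in> ?M" using one fc by auto
    then show "?M \<noteq> {}" by blast
  next
    fix a assume "a \<in> ?M"
    then have a: "a \<in> carrier G" and m: "\<And>z. z \<in> carrier G \<Longrightarrow> f (a \<otimes> z) = f a \<otimes>\<^bsub>H\<^esub> f z"
      by auto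
    have *: "f (inv a \<otimes> z) = inv\<^bsub>H\<^esub> f a \<otimes>\<^bsub>H\<^esub> f z" if z: "z \<in> carrier G" for z
    proof -
      have "f z = f a \<otimes>\<^bsub>H\<^esub> f (inv a \<otimes> z)"
        using m[of "inv a \<otimes> z"] a z by (simp add: m_assoc[symmetric])
      then show ?thesis using a z fc by (simp add: H.m_assoc[symmetric])
    qed
    from *[of \<one>] have "f (inv a) = inv\<^bsub>H\<^esub> f a" using a one fc by simp
    then show "inv a \<in> ?M" using * a by auto
  next
    fix a b assume "a \<in> ?M" "b \<in> ?M"
    then show "a \<otimes> b \<in> ?M" using fc by (auto simp: m_assoc H.m_assoc)
  qed auto
qed

section \<open>Isomorphisms of generalized Alexander quandles\<close>

lemma quandle_iso_alexander_iff:
  "f \<in> quandle_iso (alexander_quandle G \<psi>) (alexander_quandle H \<psi>') \<longleftrightarrow>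
    bij_betw f (carrier G) (carrier H) \<and>
    (\<forall>x\<in>carrier G. \<forall>y\<in>carrier G.
      f (x \<otimes>\<^bsub>G\<^esub> \<psi> (inv\<^bsub>G\<^esub> x \<otimes>\<^bsub>G\<^esub> y)) = f x \<otimes>\<^bsub>H\<^esub> \<psi>' (inv\<^bsub>H\<^esub> f x \<otimes>\<^bsub>H\<^esub> f y))"
  by (auto simp: quandle_iso_def alexander_quandle_def bij_betwE)

lemma quandle_iso_alexander_if_intertwining:
  assumes "group G" "group H" and \<chi>: "\<chi> \<in> iso G H" and \<psi>: "\<psi> \<in> carrier G \<rightarrow> carrier G"
    and int: "\<And>x. x \<in> carrier G \<Longrightarrow> \<psi>' (\<chi> x) = \<chi> (\<psi> x)"
  shows "\<chi> \<in> quandle_iso (alexander_quandle G \<psi>) (alexander_quandle H \<psi>')"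
proof -
  interpret G: group G by fact
  interpret H: group H by fact
  interpret \<chi>: group_hom G H \<chi>
    using \<chi> by unfold_locales (auto simp: iso_def)
  have "\<psi>' (inv\<^bsub>H\<^esub> \<chi> x \<otimes>\<^bsub>H\<^esub> \<chi> y) = \<chi> (\<psi> (inv\<^bsub>G\<^esub> x \<otimes>\<^bsub>G\<^esub> y))" if "x \<in> carrier G" "y \<in> carrier G" for x y
    using int[of "inv\<^bsub>G\<^esub> x \<otimes>\<^bsub>G\<^esub> y"] that by simp
  then show ?thesis
    using \<chi> \<psi> by (auto simp: quandle_iso_alexander_iff iso_def Pi_iff)
qed

text \<open>Left translations of \<open>H\<close> act transitively on \<open>Q(H, \<psi>')\<close> by quandle automorphisms, so any
  isomorphism can be corrected to preserve the unit.\<close>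

lemma obtain_unital_quandle_iso:
  assumes "group G" "group H" and \<psi>': "\<psi>' \<in> carrier H \<rightarrow> carrier H"
    and "quandle_isomorphic (alexander_quandle G \<psi>) (alexander_quandle H \<psi>')"
  obtains f where "f \<in> quandle_iso (alexander_quandle G \<psi>) (alexander_quandle H \<psi>')"
    "f \<one>\<^bsub>G\<^esub> = \<one>\<^bsub>H\<^esub>"
proof -
  interpret G: group G by fact
  interpret H: group H by fact
  obtain f where bij: "bij_betw f (carrier G) (carrier H)"
    and f: "\<And>x y. \<lbrakk>x \<in> carrier G; y \<in> carrier G\<rbrakk> \<Longrightarrow>
      f (x \<otimes>\<^bsub>G\<^esub> \<psi> (inv\<^bsub>G\<^esub> x \<otimes>\<^bsub>G\<^esub> y)) = f x \<otimes>\<^bsub>H\<^esub> \<psi>' (inv\<^bsub>H\<^esub> f x \<otimes>\<^bsub>H\<^esub> f y)"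
    using assms(4) unfolding quandle_isomorphic_def quandle_iso_alexander_iff[symmetric]
    by (metis ex_in_conv quandle_iso_alexander_iff)
  have fc: "f x \<in> carrier H" if "x \<in> carrier G" for x using bij that by (auto dest: bij_betwE)
  define c where "c = inv\<^bsub>H\<^esub> f \<one>\<^bsub>G\<^esub>"
  have c: "c \<in> carrier H" using fc by (simp add: c_def)
  let ?f = "\<lambda>x. c \<otimes>\<^bsub>H\<^esub> f x"
  have "bij_betw (\<lambda>y. c \<otimes>\<^bsub>H\<^esub> y) (carrier H) (carrier H)"
    using c by (intro bij_betw_byWitness[where f' = "\<lambda>y. inv\<^bsub>H\<^esub> c \<otimes>\<^bsub>H\<^esub> y"])
      (auto simp: H.m_assoc[symmetric])
  from bij_betw_trans[OF bij this] have "bij_betw ?f (carrier G) (carrier H)"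
    by (simp add: comp_def)
  moreover have "?f (x \<otimes>\<^bsub>G\<^esub> \<psi> (inv\<^bsub>G\<^esub> x \<otimes>\<^bsub>G\<^esub> y)) = ?f x \<otimes>\<^bsub>H\<^esub> \<psi>' (inv\<^bsub>H\<^esub> ?f x \<otimes>\<^bsub>H\<^esub> ?f y)"
    if "x \<in> carrier G" "y \<in> carrier G" for x y
  proof -
    have "inv\<^bsub>H\<^esub> c \<otimes>\<^bsub>H\<^esub> (c \<otimes>\<^bsub>H\<^esub> f y) = f y"
      using c fc that by (simp add: H.m_assoc[symmetric])
    then have "inv\<^bsub>H\<^esub> ?f x \<otimes>\<^bsub>H\<^esub> ?f y = inv\<^bsub>H\<^esub> f x \<otimes>\<^bsub>H\<^esub> f y"
      using c fc that by (simp add: H.inv_mult_group H.m_assoc)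
    moreover have "\<psi>' (inv\<^bsub>H\<^esub> f x \<otimes>\<^bsub>H\<^esub> f y) \<in> carrier H"
      using \<psi>' fc that by (simp add: Pi_iff)
    ultimately show ?thesis using f c fc that by (simp add: H.m_assoc)
  qed
  ultimately have "?f \<in> quandle_iso (alexander_quandle G \<psi>) (alexander_quandle H \<psi>')"
    by (simp add: quandle_iso_alexander_iff)
  moreover have "?f \<one>\<^bsub>G\<^esub> = \<one>\<^bsub>H\<^esub>" using fc by (simp add: c_def)
  ultimately show thesis by (rule that)
qed

lemma unital_quandle_iso_intertwines:
  assumes "group G" "group H" and \<psi>: "\<psi> \<in> carrier G \<rightarrow> carrier G"
    and \<psi>': "\<psi>' \<in> carrier H \<rightarrow> carrier H"
    and f: "f \<in> quandle_iso (alexander_quandle G \<psi>) (alexander_quandle H \<psi>')"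
    and one: "f \<one>\<^bsub>G\<^esub> = \<one>\<^bsub>H\<^esub>" and x: "x \<in> carrier G"
  shows "\<psi>' (f x) = f (\<psi> x)"
proof -
  interpret G: group G by fact
  interpret H: group H by fact
  have fx: "f x \<in> carrier H" using f x by (auto simp: quandle_iso_alexander_iff dest: bij_betwE)
  have "f (\<one>\<^bsub>G\<^esub> \<otimes>\<^bsub>G\<^esub> \<psi> (inv\<^bsub>G\<^esub> \<one>\<^bsub>G\<^esub> \<otimes>\<^bsub>G\<^esub> x)) =
      f \<one>\<^bsub>G\<^esub> \<otimes>\<^bsub>H\<^esub> \<psi>' (inv\<^bsub>H\<^esub> f \<one>\<^bsub>G\<^esub> \<otimes>\<^bsub>H\<^esub> f x)"
    using f x G.one_closed unfolding quandle_iso_alexander_iff by blast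
  then show ?thesis using one x fx \<psi> \<psi>' by (simp add: Pi_iff)
qed

text \<open>Surjectivity of \<open>\<psi>\<close> lets \<open>\<psi> y\<close> range over all of \<open>G\<close>; by intertwining, the isomorphism
  condition then reads \<open>f (\<delta> x z) = \<delta>' (f x) f z\<close> with \<open>\<delta> x = x (\<psi> x)\<inverse>\<close>, and \<open>z = \<one>\<close> identifies
  \<open>\<delta>' (f x)\<close> as \<open>f (\<delta> x)\<close>.\<close>

lemma unital_quandle_iso_mult_displacement:
  assumes "group G" "group H" and \<psi>: "\<psi> \<in> iso G G" and \<psi>': "\<psi>' \<in> hom H H"
    and f: "f \<in> quandle_iso (alexander_quandle G \<psi>) (alexander_quandle H \<psi>')"
    and one: "f \<one>\<^bsub>G\<^esub> = \<one>\<^bsub>H\<^esub>"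
    and a: "a \<in> displacements G \<psi>" and z: "z \<in> carrier G"
  shows "f (a \<otimes>\<^bsub>G\<^esub> z) = f a \<otimes>\<^bsub>H\<^esub> f z"
proof -
  interpret G: group G by fact
  interpret H: group H by fact
  interpret \<psi>: group_hom G G \<psi>
    using \<psi> by unfold_locales (auto simp: iso_def)
  interpret \<psi>': group_hom H H \<psi>'
    using \<psi>' by unfold_locales
  have fc: "f x \<in> carrier H" if "x \<in> carrier G" for x
    using f that by (auto simp: quandle_iso_alexander_iff dest: bij_betwE)
  obtain x where x: "x \<in> carrier G" and a: "a = x \<otimes>\<^bsub>G\<^esub> inv\<^bsub>G\<^esub> \<psi> x"
    using a by (auto simp: displacements_def)
  have key: "f (a \<otimes>\<^bsub>G\<^esub> w) = f x \<otimes>\<^bsub>H\<^esub> inv\<^bsub>H\<^esub> \<psi>' (f x) \<otimes>\<^bsub>H\<^esub> f w" if w: "w \<in> carrier G" for w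
  proof -
    have "w \<in> \<psi> ` carrier G" using \<psi> w by (auto simp: iso_def bij_betw_def)
    then obtain y where y: "y \<in> carrier G" "w = \<psi> y" by blast
    have "f (a \<otimes>\<^bsub>G\<^esub> w) = f (x \<otimes>\<^bsub>G\<^esub> \<psi> (inv\<^bsub>G\<^esub> x \<otimes>\<^bsub>G\<^esub> y))"
      using x y by (simp add: a G.m_assoc)
    also have "\<dots> = f x \<otimes>\<^bsub>H\<^esub> \<psi>' (inv\<^bsub>H\<^esub> f x \<otimes>\<^bsub>H\<^esub> f y)"
      using f x y by (simp add: quandle_iso_alexander_iff)
    also have "\<dots> = f x \<otimes>\<^bsub>H\<^esub> inv\<^bsub>H\<^esub> \<psi>' (f x) \<otimes>\<^bsub>H\<^esub> \<psi>' (f y)"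
      using fc x y by (simp add: H.m_assoc)
    also have "\<psi>' (f y) = f w"
      using unital_quandle_iso_intertwines[OF assms(1,2) _ _ f one y(1)] y(2)
        \<psi>.hom_closed \<psi>'.hom_closed by blast
    finally show ?thesis .
  qed
  have ac: "a \<in> carrier G" using x by (simp add: a)
  have "f a = f x \<otimes>\<^bsub>H\<^esub> inv\<^bsub>H\<^esub> \<psi>' (f x)"
    using key[of "\<one>\<^bsub>G\<^esub>"] one x fc ac by simp
  with key z show ?thesis by simp
qed

section \<open>Simple groups\<close>

theorem quandle_isomorphic_alexander_iff_conjugate:
  fixes G :: "('a, 'm) monoid_scheme" (structure)
  assumes "simple_group G" and \<psi>: "\<psi> \<in> auto G" and \<psi>': "\<psi>' \<in> auto G"
  shows "quandle_isomorphic (alexander_quandle G \<psi>) (alexander_quandle G \<psi>') \<longleftrightarrow>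
    conjugate (AutoGroup G) \<psi> \<psi>'"
proof -
  interpret simple_group G by fact
  have iso: "\<chi> \<in> iso G G" if "\<chi> \<in> auto G" for \<chi>
    using that by (auto simp: auto_def Bij_def iso_def)
  have hom: "\<psi> \<in> hom G G" "\<psi>' \<in> hom G G" using iso \<psi> \<psi>' by (auto simp: iso_def)
  have maps: "\<psi> \<in> carrier G \<rightarrow> carrier G" "\<psi>' \<in> carrier G \<rightarrow> carrier G"
    using hom by (auto simp: hom_def)
  interpret \<psi>: group_hom G G \<psi> by unfold_locales (rule hom)
  show ?thesis
  proof
    assume "conjugate (AutoGroup G) \<psi> \<psi>'"
    then obtain \<chi> where "\<chi> \<in> auto G" "\<forall>x\<in>carrier G. \<psi>' (\<chi> x) = \<chi> (\<psi> x)"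
      using conjugate_AutoGroup_iff[OF \<psi> \<psi>'] by blast
    then have "\<chi> \<in> quandle_iso (alexander_quandle G \<psi>) (alexander_quandle G \<psi>')"
      using iso maps is_group by (intro quandle_iso_alexander_if_intertwining) auto
    then show "quandle_isomorphic (alexander_quandle G \<psi>) (alexander_quandle G \<psi>')"
      by (auto simp: quandle_isomorphic_def)
  next
    assume "quandle_isomorphic (alexander_quandle G \<psi>) (alexander_quandle G \<psi>')"
    then obtain f where f: "f \<in> quandle_iso (alexander_quandle G \<psi>) (alexander_quandle G \<psi>')"
      and one: "f \<one> = \<one>"
      using obtain_unital_quandle_iso[OF is_group is_group maps(2)] by blast
    have bij: "bij_betw f (carrier G) (carrier G)"
      using f by (simp add: quandle_iso_alexander_iff)
    have int: "\<psi>' (f x) = f (\<psi> x)" if "x \<in> carrier G" for x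
      using unital_quandle_iso_intertwines[OF is_group is_group maps f one that] .
    let ?M = "{a \<in> carrier G. \<forall>z\<in>carrier G. f (a \<otimes> z) = f a \<otimes> f z}"
    have sub: "displacements G \<psi> \<subseteq> carrier G" by (auto simp: displacements_def)
    have "displacements G \<psi> \<subseteq> ?M"
      using sub unital_quandle_iso_mult_displacement[OF is_group is_group iso[OF \<psi>] hom(2) f one]
      by blast
    moreover have "subgroup ?M G"
      using bij one by (intro subgroup_left_multiplicative is_group) (auto dest: bij_betwE)
    ultimately have gen: "generate G (displacements G \<psi>) \<subseteq> ?M"
      by (rule generate_subgroup_incl)
    have "generate G (displacements G \<psi>) = carrier G \<or> generate G (displacements G \<psi>) = {\<one>}"
      using no_real_normal_subgroup generate_displacements_normal[OF hom(1)] by blast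
    then have "\<exists>\<chi>\<in>auto G. \<forall>x\<in>carrier G. \<psi>' (\<chi> x) = \<chi> (\<psi> x)"
    proof
      assume "generate G (displacements G \<psi>) = carrier G"
      with gen have mult: "f (a \<otimes> z) = f a \<otimes> f z" if "a \<in> carrier G" "z \<in> carrier G" for a z
        using that by blast
      \<comment> \<open>Elements of \<^term>\<open>auto G\<close> are extensional.\<close>
      let ?f = "restrict f (carrier G)"
      have "bij_betw ?f (carrier G) (carrier G)" using bij by (simp cong: bij_betw_cong)
      moreover have "?f \<in> hom G G" using mult bij by (auto simp: hom_def dest: bij_betwE)
      ultimately have "?f \<in> auto G" by (simp add: auto_def Bij_def)
      moreover have "\<forall>x\<in>carrier G. \<psi>' (?f x) = ?f (\<psi> x)" using int by simp
      ultimately show ?thesis by blast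
    next
      assume triv: "generate G (displacements G \<psi>) = {\<one>}"
      have fixed: "\<psi> x = x" if x: "x \<in> carrier G" for x
      proof -
        have "x \<otimes> inv (\<psi> x) \<in> generate G (displacements G \<psi>)"
          using x by (intro generate.incl) (auto simp: displacements_def)
        then show ?thesis using x triv by (simp add: inv_solve_right')
      qed
      have "\<psi>' y = y" if "y \<in> carrier G" for y
      proof -
        have "y \<in> f ` carrier G" using that bij by (simp add: bij_betw_def)
        then show ?thesis using int fixed by auto
      qed
      \<comment> \<open>Both automorphisms are the identity, so every element of \<^term>\<open>auto G\<close> conjugates them.\<close>
      then have "\<forall>x\<in>carrier G. \<psi>' (\<psi> x) = \<psi> (\<psi> x)" using fixed by simp
      with \<psi> show ?thesis by blast
    qed
    then show "conjugate (AutoGroup G) \<psi> \<psi>'" using conjugate_AutoGroup_iff[OF \<psi> \<psi>'] by blast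
  qed
qed

section \<open>Isomorphism classes and conjugacy classes\<close>

lemma bij_betw_quotient_induced:
  assumes r: "equiv A r" and s: "equiv (h ` A) s"
    and rs: "\<And>x y. \<lbrakk>x \<in> A; y \<in> A\<rbrakk> \<Longrightarrow> (x, y) \<in> r \<longleftrightarrow> (h x, h y) \<in> s"
  shows "\<exists>\<Phi>. bij_betw \<Phi> (A // r) (h ` A // s) \<and> (\<forall>x\<in>A. \<Phi> (r `` {x}) = s `` {h x})"
proof -
  define \<Phi> where "\<Phi> X = (\<Union>x\<in>X. s `` {h x})" for X
  have \<Phi>: "\<Phi> (r `` {x}) = s `` {h x}" if x: "x \<in> A" for x
  proof -
    have "s `` {h y} = s `` {h x}" if "y \<in> r `` {x}" for y
    proof -
      have "y \<in> A" using that r by (auto dest: equivE simp: equiv_def)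
      then have "(h x, h y) \<in> s" using rs x that by blast
      then show ?thesis using equiv_class_eq[OF s] by blast
    qed
    moreover have "x \<in> r `` {x}" using equiv_class_self[OF r x] .
    ultimately show ?thesis unfolding \<Phi>_def by blast
  qed
  have "inj_on \<Phi> (A // r)"
  proof (rule inj_onI)
    fix X Y assume "X \<in> A // r" "Y \<in> A // r" and eq: "\<Phi> X = \<Phi> Y"
    then obtain x y where xy: "x \<in> A" "X = r `` {x}" "y \<in> A" "Y = r `` {y}"
      by (auto elim!: quotientE)
    with eq have "s `` {h x} = s `` {h y}" by (simp add: \<Phi>)
    then have "(h x, h y) \<in> s" using xy eq_equiv_class[OF _ s] by blast
    then show "X = Y" using xy rs equiv_class_eq[OF r] by blast
  qed
  moreover have "\<Phi> ` (A // r) = h ` A // s"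
    using \<Phi> by (force simp: quotient_def)
  ultimately show ?thesis using \<Phi> unfolding bij_betw_def by blast
qed

theorem theorem1p2:
  fixes G :: "('a, 'm) monoid_scheme"
  assumes "simple_group G" and "finite (carrier G)"
  shows "(\<forall>\<psi>\<in>carrier (AutoGroup G). \<forall>\<psi>'\<in>carrier (AutoGroup G).
            quandle_isomorphic (alexander_quandle G \<psi>) (alexander_quandle G \<psi>') \<longleftrightarrow>
            conjugate (AutoGroup G) \<psi> \<psi>')
       \<and> (\<exists>\<Phi>. bij_betw \<Phi> (conjugacy_classes (AutoGroup G)) (alexander_iso_classes G) \<and>
            (\<forall>\<psi>\<in>carrier (AutoGroup G).
               \<Phi> (conjugacy_rel (AutoGroup G) `` {\<psi>}) =
               alexander_iso_rel G `` {alexander_quandle G \<psi>}))"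


proof -
  interpret simple_group G by fact
  interpret Aut: group "AutoGroup G" by (rule AutoGroup)
  have iff: "quandle_isomorphic (alexander_quandle G \<psi>) (alexander_quandle G \<psi>') \<longleftrightarrow>
      conjugate (AutoGroup G) \<psi> \<psi>'"
    if "\<psi> \<in> carrier (AutoGroup G)" "\<psi>' \<in> carrier (AutoGroup G)" for \<psi> \<psi>'
    using quandle_isomorphic_alexander_iff_conjugate[OF assms(1)] that
    by (simp add: carrier_AutoGroup)
  have "(\<psi>, \<psi>') \<in> conjugacy_rel (AutoGroup G) \<longleftrightarrow>
      (alexander_quandle G \<psi>, alexander_quandle G \<psi>') \<in> alexander_iso_rel G"
    if "\<psi> \<in> carrier (AutoGroup G)" "\<psi>' \<in> carrier (AutoGroup G)" for \<psi> \<psi>'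
    using iff that by (auto simp: conjugacy_rel_def alexander_iso_rel_def alexander_quandles_def)
  from bij_betw_quotient_induced[OF Aut.equiv_conjugacy_rel
      equiv_alexander_iso_rel[unfolded alexander_quandles_def] this]
  show ?thesis
    using iff
    unfolding conjugacy_classes_def alexander_iso_classes_def alexander_quandles_def by blast
qed

end
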